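(* Let $\mathcal{A}$ and $\mathcal{B}$ be Banach algebras and let $\varphi\in\Delta(\mathcal{B})$. If the $\varphi$-Lau product $\mathcal{A}\times_\varphi\mathcal{B}$ has an ultra central approximate identity, then $\mathcal{B}$ has an ultra central approximate identity.
   Context: $\Delta(\mathcal{B})$ is the set of non-zero multiplicative linear functionals on $\mathcal{B}$. $\mathcal{A}\times_\varphi\mathcal{B}$ is the Banach algebra $\mathcal{A}\times\mathcal{B}$ with norm $\|(a,b)\|=\|a\|_{\mathcal{A}}+\|b\|_{\mathcal{B}}$ and product $(a,b)(c,d)=(ac+\varphi(d)a+\varphi(b)c,\,bd)$ for $a,c\in\mathcal{A}$, $b,d\in\mathcal{B}$. A Banach algebra $\mathcal{C}$ has an ultra central approximate identity if there is a (not necessarily bounded) net $(e_\alpha)$ in $\mathcal{C}^{**}$ such that $ce_\alpha=e_\alpha c$ for all $\alpha$ and $e_\alpha c\to c$ in norm, for every $c\in\mathcal{C}$. (Second duals carry the first Arens product.) *)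

theory Defs
  imports "HOL-Analysis.Analysis"
begin

section \<open>Complex Banach algebras\<close>

class scaleC =
  fixes scaleC :: "complex \<Rightarrow> 'a \<Rightarrow> 'a"  (infixr \<open>*\<^sub>C\<close> 75)

class complex_normed_vector = real_normed_vector + scaleC +
  assumes scaleC_add_right: "c *\<^sub>C (x + y) = c *\<^sub>C x + c *\<^sub>C y"
    and scaleC_add_left: "(c + d) *\<^sub>C x = c *\<^sub>C x + d *\<^sub>C x"
    and scaleC_scaleC: "c *\<^sub>C d *\<^sub>C x = (c * d) *\<^sub>C x"
    and scaleC_of_real: "complex_of_real r *\<^sub>C x = r *\<^sub>R x"
    and norm_scaleC: "norm (c *\<^sub>C x) = cmod c * norm x"

text \<open>No unit is required: \<^class>\<open>real_normed_algebra\<close> is associative, with a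
  submultiplicative norm.\<close>

class complex_banach_algebra = complex_normed_vector + banach + real_normed_algebra +
  assumes mult_scaleC_left: "(c *\<^sub>C x) * y = c *\<^sub>C (x * y)"
    and mult_scaleC_right: "x * (c *\<^sub>C y) = c *\<^sub>C (x * y)"

text \<open>The product of a Lau algebra depends on the functional \<open>\<phi>\<close>, so it is not a class
  operation. The notions for second duals below therefore take the product as an argument;
  for \<^class>\<open>complex_banach_algebra\<close> it is instantiated with multiplication.\<close>

locale banach_algebra_product =
  fixes mlt :: "'c::{complex_normed_vector, banach} \<Rightarrow> 'c \<Rightarrow> 'c"
  assumes assoc: "mlt (mlt x y) z = mlt x (mlt y z)"
    and add_left: "mlt (x + y) z = mlt x z + mlt y z"
    and add_right: "mlt x (y + z) = mlt x y + mlt x z"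
    and scale_left: "mlt (c *\<^sub>C x) y = c *\<^sub>C mlt x y"
    and scale_right: "mlt x (c *\<^sub>C y) = c *\<^sub>C mlt x y"
    and norm_le: "norm (mlt x y) \<le> norm x * norm y"

lemma banach_algebra_product_times:
  "banach_algebra_product ((*) :: 'b::complex_banach_algebra \<Rightarrow> 'b \<Rightarrow> 'b)"
  by unfold_locales
    (simp_all add: mult.assoc distrib_left distrib_right mult_scaleC_left mult_scaleC_right
      norm_mult_ineq)


section \<open>Non-zero multiplicative linear functionals\<close>

definition characters :: "('b::complex_banach_algebra \<Rightarrow> complex) set"  (\<open>\<Delta>\<close>) where
  "\<Delta> = {\<phi>. (\<forall>x y. \<phi> (x + y) = \<phi> x + \<phi> y) \<and> (\<forall>c x. \<phi> (c *\<^sub>C x) = c * \<phi> x) \<and>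
            (\<forall>x y. \<phi> (x * y) = \<phi> x * \<phi> y) \<and> (\<exists>x. \<phi> x \<noteq> 0)}"

text \<open>Multiplicative linear functionals are automatically bounded, so continuity is not assumed.\<close>

lemma character_norm_le:
  fixes \<phi> :: "'b::complex_banach_algebra \<Rightarrow> complex"
  assumes "\<phi> \<in> \<Delta>"
  shows "cmod (\<phi> x) \<le> norm x"
proof (rule ccontr)
  assume "\<not> cmod (\<phi> x) \<le> norm x"
  then have lt: "norm x < cmod (\<phi> x)" by simp
  have add: "\<phi> (u + v) = \<phi> u + \<phi> v" and mul: "\<phi> (u * v) = \<phi> u * \<phi> v"
    and sc: "\<phi> (c *\<^sub>C u) = c * \<phi> u" for u v c
    using assms by (auto simp: characters_def)
  have nz: "\<phi> x \<noteq> 0" using lt norm_ge_zero[of x] by auto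
  define y where "y = inverse (\<phi> x) *\<^sub>C x"
  have \<phi>y: "\<phi> y = 1" using nz by (simp add: y_def sc)
  have ny: "norm y < 1"
    using lt nz by (simp add: y_def norm_scaleC norm_divide field_simps)
  define s where "s n = ((\<lambda>z. y * z) ^^ n) y" for n
  have s_le: "norm (s n) \<le> norm y ^ n * norm y" for n
  proof (induction n)
    case (Suc n)
    have "norm (s (Suc n)) \<le> norm y * norm (s n)"
      by (simp add: s_def norm_mult_ineq)
    also have "\<dots> \<le> norm y * (norm y ^ n * norm y)"
      by (intro mult_left_mono Suc) simp
    finally show ?case by (simp add: mult_ac)
  qed (simp add: s_def)
  have "summable (\<lambda>n. norm y ^ n * norm y)"
    using ny by (intro summable_mult2 summable_geometric) simp
  then have sm: "summable s"
    by (rule summable_comparison_test'[where N = 0]) (use s_le in simp)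
  have "suminf s = s 0 + (\<Sum>n. s (Suc n))"
    using suminf_split_head[OF sm] by simp
  also have "(\<Sum>n. s (Suc n)) = y * suminf s"
    using suminf_mult[OF sm, of y] by (simp add: s_def)
  also have "s 0 = y" by (simp add: s_def)
  finally have "suminf s = y + y * suminf s" .
  then have "\<phi> (suminf s) = \<phi> y + \<phi> y * \<phi> (suminf s)" by (metis add mul)
  then show False by (simp add: \<phi>y)
qed


section \<open>The dual space\<close>

typedef (overloaded) 'a cdual =
    "{f :: 'a::complex_normed_vector \<Rightarrow> complex. bounded_linear f \<and> (\<forall>c x. f (c *\<^sub>C x) = c * f x)}"
  morphisms cdual_apply CDual
  by (rule exI[of _ "\<lambda>_. 0"]) simp

setup_lifting type_definition_cdual

lemma cdual_eqI: "(\<And>x. cdual_apply f x = cdual_apply g x) \<Longrightarrow> f = g"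
  by transfer auto

lemma bounded_linear_cdual_apply: "bounded_linear (cdual_apply f)"
  by transfer simp

lemma cdual_apply_scaleC: "cdual_apply f (c *\<^sub>C x) = c * cdual_apply f x"
  by transfer simp

lemma cdual_apply_add: "cdual_apply f (x + y) = cdual_apply f x + cdual_apply f y"
  by (rule linear_add[OF bounded_linear.linear[OF bounded_linear_cdual_apply]])

instantiation cdual :: (complex_normed_vector) complex_normed_vector
begin

lift_definition zero_cdual :: "'a cdual" is "\<lambda>_. 0" by simp
lift_definition plus_cdual :: "'a cdual \<Rightarrow> 'a cdual \<Rightarrow> 'a cdual" is "\<lambda>f g x. f x + g x"
  by (simp add: bounded_linear_add distrib_left)
lift_definition minus_cdual :: "'a cdual \<Rightarrow> 'a cdual \<Rightarrow> 'a cdual" is "\<lambda>f g x. f x - g x"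
  by (simp add: bounded_linear_sub right_diff_distrib)
lift_definition uminus_cdual :: "'a cdual \<Rightarrow> 'a cdual" is "\<lambda>f x. - f x"
  by (simp add: bounded_linear_minus)
lift_definition scaleR_cdual :: "real \<Rightarrow> 'a cdual \<Rightarrow> 'a cdual" is "\<lambda>r f x. r *\<^sub>R f x"
  by (simp add: bounded_linear_const_scaleR)
lift_definition scaleC_cdual :: "complex \<Rightarrow> 'a cdual \<Rightarrow> 'a cdual" is "\<lambda>c f x. c * f x"
  by (simp add: bounded_linear_const_mult mult.left_commute)
lift_definition norm_cdual :: "'a cdual \<Rightarrow> real" is onorm .

definition dist_cdual :: "'a cdual \<Rightarrow> 'a cdual \<Rightarrow> real" where
  "dist_cdual f g = norm (f - g)"
definition sgn_cdual :: "'a cdual \<Rightarrow> 'a cdual" where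
  "sgn_cdual f = inverse (norm f) *\<^sub>R f"
definition uniformity_cdual :: "('a cdual \<times> 'a cdual) filter" where
  "uniformity_cdual = (INF e\<in>{0<..}. principal {(f, g). dist f g < e})"
definition open_cdual :: "'a cdual set \<Rightarrow> bool" where
  "open_cdual U = (\<forall>x\<in>U. \<forall>\<^sub>F (x', y) in uniformity. x' = x \<longrightarrow> y \<in> U)"

instance
proof
  fix f g h :: "'a cdual" and r s :: real and c d :: complex and U :: "'a cdual set"
  show "f + g + h = f + (g + h)" "f + g = g + f" "0 + f = f" "- f + f = 0" "f - g = f + - g"
    by (transfer; simp add: add_ac)+
  show "r *\<^sub>R (f + g) = r *\<^sub>R f + r *\<^sub>R g" "(r + s) *\<^sub>R f = r *\<^sub>R f + s *\<^sub>R f"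
    "r *\<^sub>R s *\<^sub>R f = (r * s) *\<^sub>R f" "1 *\<^sub>R f = f"
    by (transfer; simp add: scaleR_add_right scaleR_add_left)+
  show "c *\<^sub>C (f + g) = c *\<^sub>C f + c *\<^sub>C g" "(c + d) *\<^sub>C f = c *\<^sub>C f + d *\<^sub>C f"
    "c *\<^sub>C d *\<^sub>C f = (c * d) *\<^sub>C f"
    by (transfer; simp add: algebra_simps)+
  show "complex_of_real r *\<^sub>C f = r *\<^sub>R f"
    by transfer (simp add: scaleR_conv_of_real)
  show "dist f g = norm (f - g)" by (rule dist_cdual_def)
  show "sgn f = inverse (norm f) *\<^sub>R f" by (rule sgn_cdual_def)
  show "uniformity = (INF e\<in>{0<..}. principal {(f, g::'a cdual). dist f g < e})"
    by (rule uniformity_cdual_def)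
  show "open U = (\<forall>x\<in>U. \<forall>\<^sub>F (x', y) in uniformity. x' = x \<longrightarrow> y \<in> U)"
    by (rule open_cdual_def)
  show "(norm f = 0) = (f = 0)"
    by transfer (auto simp: onorm_eq_0 fun_eq_iff)
  show "norm (f + g) \<le> norm f + norm g"
    by transfer (simp add: onorm_triangle)
  show "norm (r *\<^sub>R f) = \<bar>r\<bar> * norm f"
    by transfer (simp add: onorm_scaleR)
  show "norm (c *\<^sub>C f) = cmod c * norm f"
  proof transfer
    fix c :: complex and f :: "'a \<Rightarrow> complex"
    assume *: "bounded_linear f \<and> (\<forall>c x. f (c *\<^sub>C x) = c * f x)"
    have bl: "bounded_linear (\<lambda>x. d * k x)" if "bounded_linear k" for d and k :: "'a \<Rightarrow> complex"
      using that by (simp add: bounded_linear_const_mult)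
    have le: "onorm (\<lambda>x. d * k x) \<le> cmod d * onorm k"
      if "bounded_linear k" for d and k :: "'a \<Rightarrow> complex"
    proof (rule onorm_bound)
      show "0 \<le> cmod d * onorm k" using onorm_pos_le[OF that] by simp
      show "cmod (d * k x) \<le> cmod d * onorm k * norm x" for x
        using onorm[OF that, of x] by (simp add: norm_mult mult.assoc mult_left_mono)
    qed
    show "onorm (\<lambda>x. c * f x) = cmod c * onorm f"
    proof (cases "c = 0")
      case True
      then show ?thesis by (simp add: onorm_zero)
    next
      case False
      have "onorm f \<le> cmod (inverse c) * onorm (\<lambda>x. c * f x)"
        using le[of "\<lambda>x. c * f x" "inverse c"] bl[of f c] * False
        by (simp add: mult.assoc[symmetric])
      then have "cmod c * onorm f \<le> onorm (\<lambda>x. c * f x)"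
        using False by (simp add: norm_divide field_simps)
      then show ?thesis using le[of f c] * by simp
    qed
  qed
qed

end

lemma cdual_apply_plus [simp]: "cdual_apply (f + g) x = cdual_apply f x + cdual_apply g x"
  by transfer simp

lemma cdual_apply_minus [simp]: "cdual_apply (f - g) x = cdual_apply f x - cdual_apply g x"
  by transfer simp

lemma cdual_apply_times [simp]: "cdual_apply (c *\<^sub>C f) x = c * cdual_apply f x"
  by transfer simp

lemma norm_cdual_apply: "cmod (cdual_apply f x) \<le> norm f * norm x"
  by transfer (simp add: onorm)

lemma CDual_apply:
  assumes "\<And>x y. f (x + y) = f x + f y" and "\<And>c x. f (c *\<^sub>C x) = c * f x"
    and "\<And>x. cmod (f x) \<le> K * norm x"
  shows "cdual_apply (CDual f) x = f x"
proof -
  have "f (r *\<^sub>R x) = r *\<^sub>R f x" for r x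
    using assms(2)[of "complex_of_real r" x] by (simp add: scaleC_of_real scaleR_conv_of_real)
  then have "bounded_linear f"
    by (intro bounded_linear_intro[of f K]) (auto simp: assms mult.commute)
  then show ?thesis by (subst CDual_inverse) (auto simp: assms)
qed

lemma norm_CDual_le:
  assumes "\<And>x y. f (x + y) = f x + f y" and "\<And>c x. f (c *\<^sub>C x) = c * f x"
    and "\<And>x. cmod (f x) \<le> K * norm x" and "0 \<le> K"
  shows "norm (CDual f) \<le> K"
proof -
  have "cdual_apply (CDual f) = f" using CDual_apply[of f K] assms by blast
  then show ?thesis
    by (simp add: norm_cdual.rep_eq onorm_bound assms)
qed

type_synonym 'a bidual = "'a cdual cdual"

definition canonical_embedding :: "'a::complex_normed_vector \<Rightarrow> 'a bidual"  (\<open>\<kappa>\<close>) where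
  "\<kappa> x = CDual (\<lambda>f. cdual_apply f x)"

lemma cdual_apply_\<kappa>: "cdual_apply (\<kappa> x) f = cdual_apply f x"
  unfolding canonical_embedding_def
  by (rule CDual_apply[where K = "norm x"]) (use norm_cdual_apply in \<open>auto simp: mult.commute\<close>)


section \<open>The first Arens product\<close>

text \<open>For \<open>f\<close> in the dual and \<open>m\<close>, \<open>n\<close> in the second dual:
  \<open>\<langle>f \<cdot> a, b\<rangle> = \<langle>f, a b\<rangle>\<close>, \<open>\<langle>n \<cdot> f, a\<rangle> = \<langle>n, f \<cdot> a\<rangle>\<close> and \<open>\<langle>m \<box> n, f\<rangle> = \<langle>m, n \<cdot> f\<rangle>\<close>.\<close>

definition dual_act :: "('c::complex_normed_vector \<Rightarrow> 'c \<Rightarrow> 'c) \<Rightarrow> 'c cdual \<Rightarrow> 'c \<Rightarrow> 'c cdual" where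
  "dual_act mlt f a = CDual (\<lambda>b. cdual_apply f (mlt a b))"

definition bidual_act ::
    "('c::complex_normed_vector \<Rightarrow> 'c \<Rightarrow> 'c) \<Rightarrow> 'c bidual \<Rightarrow> 'c cdual \<Rightarrow> 'c cdual" where
  "bidual_act mlt n f = CDual (\<lambda>a. cdual_apply n (dual_act mlt f a))"

definition arens ::
    "('c::complex_normed_vector \<Rightarrow> 'c \<Rightarrow> 'c) \<Rightarrow> 'c bidual \<Rightarrow> 'c bidual \<Rightarrow> 'c bidual" where
  "arens mlt m n = CDual (\<lambda>f. cdual_apply m (bidual_act mlt n f))"

text \<open>For a Banach algebra product the arguments of \<^const>\<open>CDual\<close> above are bounded linear
  functionals.\<close>

context banach_algebra_product
begin

lemma dual_act_bound: "cmod (cdual_apply f (mlt a b)) \<le> norm f * norm a * norm b"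
proof -
  have "cmod (cdual_apply f (mlt a b)) \<le> norm f * norm (mlt a b)" by (rule norm_cdual_apply)
  also have "\<dots> \<le> norm f * (norm a * norm b)" by (intro mult_left_mono norm_le) simp
  finally show ?thesis by (simp add: mult.assoc)
qed

lemma apply_dual_act: "cdual_apply (dual_act mlt f a) b = cdual_apply f (mlt a b)"
  unfolding dual_act_def
  by (rule CDual_apply[where K = "norm f * norm a"])
    (simp_all add: add_right scale_right cdual_apply_add cdual_apply_scaleC dual_act_bound)

lemma norm_dual_act: "norm (dual_act mlt f a) \<le> norm f * norm a"
  unfolding dual_act_def
  by (rule norm_CDual_le)
    (simp_all add: add_right scale_right cdual_apply_add cdual_apply_scaleC dual_act_bound)

lemma dual_act_linear:
  "dual_act mlt f (a + b) = dual_act mlt f a + dual_act mlt f b"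
  "dual_act mlt f (c *\<^sub>C a) = c *\<^sub>C dual_act mlt f a"
  "dual_act mlt (f + g) a = dual_act mlt f a + dual_act mlt g a"
  "dual_act mlt (c *\<^sub>C f) a = c *\<^sub>C dual_act mlt f a"
  by (rule cdual_eqI; simp add: apply_dual_act add_left scale_left cdual_apply_add
      cdual_apply_scaleC)+

lemma bidual_act_bound: "cmod (cdual_apply n (dual_act mlt f a)) \<le> norm n * norm f * norm a"
proof -
  have "cmod (cdual_apply n (dual_act mlt f a)) \<le> norm n * norm (dual_act mlt f a)"
    by (rule norm_cdual_apply)
  also have "\<dots> \<le> norm n * (norm f * norm a)" by (intro mult_left_mono norm_dual_act) simp
  finally show ?thesis by (simp add: mult.assoc)
qed

lemma apply_bidual_act:
  "cdual_apply (bidual_act mlt n f) a = cdual_apply n (dual_act mlt f a)"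
  unfolding bidual_act_def
  by (rule CDual_apply[where K = "norm n * norm f"])
    (simp_all add: dual_act_linear cdual_apply_add cdual_apply_scaleC bidual_act_bound)

lemma norm_bidual_act: "norm (bidual_act mlt n f) \<le> norm n * norm f"
  unfolding bidual_act_def
  by (rule norm_CDual_le)
    (simp_all add: dual_act_linear cdual_apply_add cdual_apply_scaleC bidual_act_bound)

lemma bidual_act_linear:
  "bidual_act mlt n (f + g) = bidual_act mlt n f + bidual_act mlt n g"
  "bidual_act mlt n (c *\<^sub>C f) = c *\<^sub>C bidual_act mlt n f"
  by (rule cdual_eqI; simp add: apply_bidual_act dual_act_linear cdual_apply_add
      cdual_apply_scaleC)+

lemma apply_arens: "cdual_apply (arens mlt m n) f = cdual_apply m (bidual_act mlt n f)"
  unfolding arens_def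
proof (rule CDual_apply[where K = "norm m * norm n"])
  fix f
  have "cmod (cdual_apply m (bidual_act mlt n f)) \<le> norm m * norm (bidual_act mlt n f)"
    by (rule norm_cdual_apply)
  also have "\<dots> \<le> norm m * (norm n * norm f)" by (intro mult_left_mono norm_bidual_act) simp
  finally show "cmod (cdual_apply m (bidual_act mlt n f)) \<le> norm m * norm n * norm f"
    by (simp add: mult.assoc)
qed (simp_all add: bidual_act_linear cdual_apply_add cdual_apply_scaleC)

lemma arens_\<kappa>: "arens mlt (\<kappa> a) (\<kappa> b) = \<kappa> (mlt a b)"
  by (rule cdual_eqI) (simp add: apply_arens cdual_apply_\<kappa> apply_bidual_act apply_dual_act)

end


section \<open>Ultra central approximate identities\<close>

definition directed_set :: "'i set \<Rightarrow> ('i \<Rightarrow> 'i \<Rightarrow> bool) \<Rightarrow> bool" where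
  "directed_set I le \<longleftrightarrow> I \<noteq> {} \<and> (\<forall>i\<in>I. le i i) \<and>
     (\<forall>i\<in>I. \<forall>j\<in>I. \<forall>k\<in>I. le i j \<longrightarrow> le j k \<longrightarrow> le i k) \<and>
     (\<forall>i\<in>I. \<forall>j\<in>I. \<exists>k\<in>I. le i k \<and> le j k)"

definition net_norm_converges ::
    "'i set \<Rightarrow> ('i \<Rightarrow> 'i \<Rightarrow> bool) \<Rightarrow> ('i \<Rightarrow> 'x::real_normed_vector) \<Rightarrow> 'x \<Rightarrow> bool" where
  "net_norm_converges I le x l \<longleftrightarrow>
     (\<forall>\<epsilon>>0. \<exists>i\<^sub>0\<in>I. \<forall>i\<in>I. le i\<^sub>0 i \<longrightarrow> norm (x i - l) < \<epsilon>)"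

definition ultra_central_approximate_identity ::
    "('c::complex_normed_vector \<Rightarrow> 'c \<Rightarrow> 'c) \<Rightarrow> 'i set \<Rightarrow> ('i \<Rightarrow> 'i \<Rightarrow> bool) \<Rightarrow> ('i \<Rightarrow> 'c bidual) \<Rightarrow> bool"
where
  "ultra_central_approximate_identity mlt I le e \<longleftrightarrow> directed_set I le \<and>
     (\<forall>c. \<forall>i\<in>I. arens mlt (\<kappa> c) (e i) = arens mlt (e i) (\<kappa> c)) \<and>
     (\<forall>c. net_norm_converges I le (\<lambda>i. arens mlt (e i) (\<kappa> c)) (\<kappa> c))"

text \<open>One cannot quantify existentially over the type of indices, so a type is fixed here; by
  the lemma that follows it, this does not restrict the nets.\<close>

definition has_ultra_central_approximate_identity ::
    "('c::complex_normed_vector \<Rightarrow> 'c \<Rightarrow> 'c) \<Rightarrow> bool" where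
  "has_ultra_central_approximate_identity mlt \<longleftrightarrow>
     (\<exists>(I :: ('c set \<times> nat) set) le e. ultra_central_approximate_identity mlt I le e)"

lemma has_ultra_central_approximate_identityI:
  fixes I :: "'i set" and mlt :: "'c::complex_normed_vector \<Rightarrow> 'c \<Rightarrow> 'c"
  assumes "ultra_central_approximate_identity mlt I le e"
  shows "has_ultra_central_approximate_identity mlt"
proof -
  have dir: "directed_set I le"
    and com: "\<And>c i. i \<in> I \<Longrightarrow> arens mlt (\<kappa> c) (e i) = arens mlt (e i) (\<kappa> c)"
    and cnv: "\<And>c. net_norm_converges I le (\<lambda>i. arens mlt (e i) (\<kappa> c)) (\<kappa> c)"
    using assms unfolding ultra_central_approximate_identity_def by blast+
  have ex: "\<exists>i\<in>I. \<forall>c\<in>F. \<forall>j\<in>I. le i j \<longrightarrow> norm (arens mlt (e j) (\<kappa> c) - \<kappa> c) < \<epsilon>"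
    if "finite F" "\<epsilon> > 0" for F \<epsilon>
    using that(1)
  proof induction
    case empty
    have "I \<noteq> {}" using dir unfolding directed_set_def by blast
    then show ?case by auto
  next
    case (insert c F)
    then obtain i where i: "i \<in> I"
      "\<forall>c\<in>F. \<forall>j\<in>I. le i j \<longrightarrow> norm (arens mlt (e j) (\<kappa> c) - \<kappa> c) < \<epsilon>" by blast
    obtain j where j: "j \<in> I" "\<forall>k\<in>I. le j k \<longrightarrow> norm (arens mlt (e k) (\<kappa> c) - \<kappa> c) < \<epsilon>"
      using cnv[of c] \<open>\<epsilon> > 0\<close> unfolding net_norm_converges_def by blast
    obtain k where k: "k \<in> I" "le i k" "le j k"
      using dir i(1) j(1) unfolding directed_set_def by blast
    have "le i l" "le j l" if "l \<in> I" "le k l" for l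
      using dir i(1) j(1) k that unfolding directed_set_def by blast+
    then show ?case using i(2) j(2) k(1) by (intro bexI[of _ k]) auto
  qed
  define J where "J = {p :: 'c set \<times> nat. finite (fst p)}"
  define le' where "le' p q \<longleftrightarrow> fst p \<subseteq> fst q \<and> snd p \<le> snd q" for p q :: "'c set \<times> nat"
  have "\<forall>p\<in>J. \<exists>i\<in>I. \<forall>c\<in>fst p. norm (arens mlt (e i) (\<kappa> c) - \<kappa> c) < inverse (real (Suc (snd p)))"
  proof
    fix p assume "p \<in> J"
    then obtain i where "i \<in> I" "\<forall>c\<in>fst p. \<forall>j\<in>I. le i j \<longrightarrow>
        norm (arens mlt (e j) (\<kappa> c) - \<kappa> c) < inverse (real (Suc (snd p)))"
      using ex[of "fst p" "inverse (real (Suc (snd p)))"] by (auto simp: J_def)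
    moreover have "le i i" using dir \<open>i \<in> I\<close> unfolding directed_set_def by blast
    ultimately show "\<exists>i\<in>I. \<forall>c\<in>fst p.
        norm (arens mlt (e i) (\<kappa> c) - \<kappa> c) < inverse (real (Suc (snd p)))" by blast
  qed
  then obtain h where h: "\<And>p. p \<in> J \<Longrightarrow> h p \<in> I"
    "\<And>p c. p \<in> J \<Longrightarrow> c \<in> fst p \<Longrightarrow>
      norm (arens mlt (e (h p)) (\<kappa> c) - \<kappa> c) < inverse (real (Suc (snd p)))"
    by metis
  have "directed_set J le'"
    unfolding directed_set_def
  proof (intro conjI ballI impI)
    show "J \<noteq> {}" by (auto simp: J_def)
    fix p q assume "p \<in> J" "q \<in> J"
    then show "\<exists>r\<in>J. le' p r \<and> le' q r"
      by (intro bexI[of _ "(fst p \<union> fst q, max (snd p) (snd q))"]) (auto simp: J_def le'_def)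
  qed (auto simp: le'_def)
  moreover have "net_norm_converges J le' (\<lambda>p. arens mlt (e (h p)) (\<kappa> c)) (\<kappa> c)" for c
    unfolding net_norm_converges_def
  proof (intro allI impI)
    fix \<epsilon> :: real assume "\<epsilon> > 0"
    then obtain n where n: "inverse (real (Suc n)) < \<epsilon>" using reals_Archimedean by blast
    show "\<exists>p\<in>J. \<forall>q\<in>J. le' p q \<longrightarrow> norm (arens mlt (e (h q)) (\<kappa> c) - \<kappa> c) < \<epsilon>"
    proof (intro bexI[of _ "({c}, n)"] ballI impI)
      fix q assume q: "q \<in> J" "le' ({c}, n) q"
      then have "norm (arens mlt (e (h q)) (\<kappa> c) - \<kappa> c) < inverse (real (Suc (snd q)))"
        by (intro h(2)) (auto simp: le'_def)
      also have "\<dots> \<le> inverse (real (Suc n))"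
        using q(2) by (intro le_imp_inverse_le) (auto simp: le'_def)
      finally show "norm (arens mlt (e (h q)) (\<kappa> c) - \<kappa> c) < \<epsilon>" using n by simp
    qed (simp add: J_def)
  qed
  ultimately have "ultra_central_approximate_identity mlt J le' (\<lambda>p. e (h p))"
    unfolding ultra_central_approximate_identity_def using com h(1) by blast
  then show ?thesis unfolding has_ultra_central_approximate_identity_def by blast
qed


section \<open>The Lau product\<close>

text \<open>A separate type, since the library norms the product type by the Euclidean norm.\<close>

datatype ('a, 'b) l1_prod = L1 (l1_fst: 'a) (l1_snd: 'b)

instantiation l1_prod :: (complex_normed_vector, complex_normed_vector) complex_normed_vector
begin

definition zero_l1_prod :: "('a, 'b) l1_prod" where
  "0 = L1 0 0"
definition plus_l1_prod :: "('a, 'b) l1_prod \<Rightarrow> ('a, 'b) l1_prod \<Rightarrow> ('a, 'b) l1_prod" where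
  "x + y = L1 (l1_fst x + l1_fst y) (l1_snd x + l1_snd y)"
definition minus_l1_prod :: "('a, 'b) l1_prod \<Rightarrow> ('a, 'b) l1_prod \<Rightarrow> ('a, 'b) l1_prod" where
  "x - y = L1 (l1_fst x - l1_fst y) (l1_snd x - l1_snd y)"
definition uminus_l1_prod :: "('a, 'b) l1_prod \<Rightarrow> ('a, 'b) l1_prod" where
  "- x = L1 (- l1_fst x) (- l1_snd x)"
definition scaleR_l1_prod :: "real \<Rightarrow> ('a, 'b) l1_prod \<Rightarrow> ('a, 'b) l1_prod" where
  "r *\<^sub>R x = L1 (r *\<^sub>R l1_fst x) (r *\<^sub>R l1_snd x)"
definition scaleC_l1_prod :: "complex \<Rightarrow> ('a, 'b) l1_prod \<Rightarrow> ('a, 'b) l1_prod" where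
  "c *\<^sub>C x = L1 (c *\<^sub>C l1_fst x) (c *\<^sub>C l1_snd x)"
definition norm_l1_prod :: "('a, 'b) l1_prod \<Rightarrow> real" where
  "norm x = norm (l1_fst x) + norm (l1_snd x)"
definition dist_l1_prod :: "('a, 'b) l1_prod \<Rightarrow> ('a, 'b) l1_prod \<Rightarrow> real" where
  "dist_l1_prod x y = norm (x - y)"
definition sgn_l1_prod :: "('a, 'b) l1_prod \<Rightarrow> ('a, 'b) l1_prod" where
  "sgn_l1_prod x = inverse (norm x) *\<^sub>R x"
definition uniformity_l1_prod :: "(('a, 'b) l1_prod \<times> ('a, 'b) l1_prod) filter" where
  "uniformity_l1_prod = (INF e\<in>{0<..}. principal {(x, y). dist x y < e})"
definition open_l1_prod :: "('a, 'b) l1_prod set \<Rightarrow> bool" where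
  "open_l1_prod U = (\<forall>x\<in>U. \<forall>\<^sub>F (x', y) in uniformity. x' = x \<longrightarrow> y \<in> U)"

lemmas l1_prod_defs = zero_l1_prod_def plus_l1_prod_def minus_l1_prod_def uminus_l1_prod_def
  scaleR_l1_prod_def scaleC_l1_prod_def norm_l1_prod_def

instance
proof
  fix x y z :: "('a, 'b) l1_prod" and r s :: real and c d :: complex
    and U :: "('a, 'b) l1_prod set"
  show "x + y + z = x + (y + z)" "x + y = y + x" "0 + x = x" "- x + x = 0" "x - y = x + - y"
    by (simp_all add: l1_prod_defs add_ac)
  show "r *\<^sub>R (x + y) = r *\<^sub>R x + r *\<^sub>R y" "(r + s) *\<^sub>R x = r *\<^sub>R x + s *\<^sub>R x"
    "r *\<^sub>R s *\<^sub>R x = (r * s) *\<^sub>R x" "1 *\<^sub>R x = x"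
    by (simp_all add: l1_prod_defs scaleR_add_right scaleR_add_left)
  show "c *\<^sub>C (x + y) = c *\<^sub>C x + c *\<^sub>C y" "(c + d) *\<^sub>C x = c *\<^sub>C x + d *\<^sub>C x"
    "c *\<^sub>C d *\<^sub>C x = (c * d) *\<^sub>C x" "complex_of_real r *\<^sub>C x = r *\<^sub>R x"
    by (simp_all add: l1_prod_defs scaleC_add_right scaleC_add_left scaleC_scaleC scaleC_of_real)
  show "dist x y = norm (x - y)" by (rule dist_l1_prod_def)
  show "sgn x = inverse (norm x) *\<^sub>R x" by (rule sgn_l1_prod_def)
  show "uniformity = (INF e\<in>{0<..}. principal {(x, y::('a, 'b) l1_prod). dist x y < e})"
    by (rule uniformity_l1_prod_def)
  show "open U = (\<forall>x\<in>U. \<forall>\<^sub>F (x', y) in uniformity. x' = x \<longrightarrow> y \<in> U)"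
    by (rule open_l1_prod_def)
  show "(norm x = 0) = (x = 0)"
    by (cases x) (simp add: l1_prod_defs add_nonneg_eq_0_iff)
  show "norm (x + y) \<le> norm x + norm y"
    using norm_triangle_ineq[of "l1_fst x" "l1_fst y"] norm_triangle_ineq[of "l1_snd x" "l1_snd y"]
    by (simp add: l1_prod_defs)
  show "norm (r *\<^sub>R x) = \<bar>r\<bar> * norm x" "norm (c *\<^sub>C x) = cmod c * norm x"
    by (simp_all add: l1_prod_defs norm_scaleC distrib_left)
qed

end

instance l1_prod ::
  ("{complex_normed_vector, banach}", "{complex_normed_vector, banach}") banach
proof
  fix X :: "nat \<Rightarrow> ('a, 'b) l1_prod"
  assume X: "Cauchy X"
  have *: "dist (l1_fst x) (l1_fst y) \<le> dist x y" "dist (l1_snd x) (l1_snd y) \<le> dist x y"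
    for x y :: "('a, 'b) l1_prod"
    by (simp_all add: dist_norm l1_prod_defs)
  have "Cauchy (\<lambda>n. l1_fst (X n))" "Cauchy (\<lambda>n. l1_snd (X n))"
    using X unfolding Cauchy_def by (meson * le_less_trans)+
  then obtain a b where ab: "(\<lambda>n. l1_fst (X n)) \<longlonglongrightarrow> a" "(\<lambda>n. l1_snd (X n)) \<longlonglongrightarrow> b"
    by (meson Cauchy_convergent convergentD)
  have "(\<lambda>n. norm (l1_fst (X n) - a) + norm (l1_snd (X n) - b)) \<longlonglongrightarrow> 0 + 0"
    by (intro tendsto_add tendsto_norm_zero) (use ab in \<open>simp_all add: LIM_zero\<close>)
  then have "(\<lambda>n. norm (X n - L1 a b)) \<longlonglongrightarrow> 0" by (simp add: l1_prod_defs)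
  then have "X \<longlonglongrightarrow> L1 a b" by (simp add: tendsto_norm_zero_iff LIM_zero_iff)
  then show "convergent X" by (rule convergentI)
qed

definition lau_mult ::
    "('b \<Rightarrow> complex) \<Rightarrow> ('a::complex_banach_algebra, 'b::complex_banach_algebra) l1_prod
      \<Rightarrow> ('a, 'b) l1_prod \<Rightarrow> ('a, 'b) l1_prod" where
  "lau_mult \<phi> x y =
     L1 (l1_fst x * l1_fst y + \<phi> (l1_snd y) *\<^sub>C l1_fst x + \<phi> (l1_snd x) *\<^sub>C l1_fst y)
        (l1_snd x * l1_snd y)"

lemma banach_algebra_product_lau_mult:
  fixes \<phi> :: "'b::complex_banach_algebra \<Rightarrow> complex"
  assumes "\<phi> \<in> \<Delta>"
  shows "banach_algebra_product
    (lau_mult \<phi> :: ('a::complex_banach_algebra, 'b) l1_prod \<Rightarrow> _ \<Rightarrow> _)"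
proof
  have \<phi>: "\<phi> (u + v) = \<phi> u + \<phi> v" "\<phi> (u * v) = \<phi> u * \<phi> v" "\<phi> (c *\<^sub>C u) = c * \<phi> u" for u v c
    using assms by (auto simp: characters_def)
  note defs = lau_mult_def l1_prod_defs
  fix x y z :: "('a, 'b) l1_prod" and c :: complex
  show "lau_mult \<phi> (lau_mult \<phi> x y) z = lau_mult \<phi> x (lau_mult \<phi> y z)"
    by (simp add: defs \<phi> scaleC_add_right scaleC_scaleC mult_scaleC_left mult_scaleC_right
        distrib_left distrib_right mult.assoc[where 'a = 'a] mult.assoc[where 'a = 'b]
        mult.commute[where 'a = complex] add_ac)
  show "lau_mult \<phi> (x + y) z = lau_mult \<phi> x z + lau_mult \<phi> y z"
    "lau_mult \<phi> x (y + z) = lau_mult \<phi> x y + lau_mult \<phi> x z"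
    by (simp_all add: defs \<phi> scaleC_add_left scaleC_add_right distrib_left distrib_right add_ac)
  show "lau_mult \<phi> (c *\<^sub>C x) y = c *\<^sub>C lau_mult \<phi> x y"
    "lau_mult \<phi> x (c *\<^sub>C y) = c *\<^sub>C lau_mult \<phi> x y"
    by (simp_all add: defs \<phi> scaleC_add_right scaleC_scaleC mult_scaleC_left mult_scaleC_right
        mult.commute[of "\<phi> _" c])
  obtain a b where x: "x = L1 a b" by (cases x)
  obtain a' b' where y: "y = L1 a' b'" by (cases y)
  have "norm (a * a' + \<phi> b' *\<^sub>C a + \<phi> b *\<^sub>C a')
      \<le> norm (a * a') + norm (\<phi> b' *\<^sub>C a) + norm (\<phi> b *\<^sub>C a')"
    by (intro norm_triangle_le add_right_mono norm_triangle_ineq)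
  also have "\<dots> \<le> norm a * norm a' + norm b' * norm a + norm b * norm a'"
    unfolding norm_scaleC
    by (intro add_mono mult_right_mono norm_mult_ineq character_norm_le assms) simp_all
  finally show "norm (lau_mult \<phi> x y) \<le> norm x * norm y"
    using norm_mult_ineq[of b b'] by (simp add: x y lau_mult_def norm_l1_prod_def algebra_simps)
qed

end

theory Submission
  imports Defs
begin

text \<open>
  The coordinate projection of \<open>\<A> \<times>\<^sub>\<phi> \<B>\<close> onto \<open>\<B>\<close> is a bounded surjective algebra homomorphism,
  because \<open>\<phi>\<close> enters only the first coordinate of the product. The property is inherited along
  every bounded homomorphism \<open>T : \<C> \<rightarrow> \<D>\<close> of Banach algebras with \<open>T(\<C>) = \<D>\<close>. The double adjoint
  \<open>T\<^sup>*\<^sup>*\<close> is bounded, is multiplicative for the first Arens products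
  (lemma \<open>arens_double_adjoint\<close>) and extends \<open>T\<close> (lemma \<open>double_adjoint_canonical_embedding\<close>).
  Applied to a net \<open>(e\<^sub>\<alpha>)\<close> in \<open>\<C>\<^sup>*\<^sup>*\<close>, it therefore turns \<open>c e\<^sub>\<alpha> = e\<^sub>\<alpha> c\<close> and \<open>e\<^sub>\<alpha> c \<rightarrow> c\<close> into the same
  statements about \<open>T\<^sup>*\<^sup>* e\<^sub>\<alpha>\<close> and \<open>T c\<close>, and by surjectivity the elements \<open>T c\<close> are all of \<open>\<D>\<close>.
\<close>

section \<open>Adjoints of bounded complex-linear maps\<close>

locale bounded_complex_linear =
  fixes T :: "'c::complex_normed_vector \<Rightarrow> 'd::complex_normed_vector" and K :: real
  assumes map_add: "T (x + y) = T x + T y"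
    and map_scaleC: "T (c *\<^sub>C x) = c *\<^sub>C T x"
    and norm_map_le: "norm (T x) \<le> K * norm x"
    and bound_nonneg: "0 \<le> K"

definition adjoint :: "('c::complex_normed_vector \<Rightarrow> 'd::complex_normed_vector)
    \<Rightarrow> 'd cdual \<Rightarrow> 'c cdual" where
  "adjoint T f = CDual (\<lambda>x. cdual_apply f (T x))"

context bounded_complex_linear
begin

lemma map_diff: "T (x - y) = T x - T y"
  using map_add[of "x - y" y] by (simp add: eq_diff_eq)

lemma adjoint_bound: "cmod (cdual_apply f (T x)) \<le> K * norm f * norm x"
proof -
  have "cmod (cdual_apply f (T x)) \<le> norm f * norm (T x)" by (rule norm_cdual_apply)
  also have "\<dots> \<le> norm f * (K * norm x)" by (intro mult_left_mono norm_map_le) simp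
  finally show ?thesis by (simp add: mult_ac)
qed

lemma apply_adjoint: "cdual_apply (adjoint T f) x = cdual_apply f (T x)"
  unfolding adjoint_def
  by (rule CDual_apply[where K = "K * norm f"])
    (simp_all add: map_add map_scaleC cdual_apply_add cdual_apply_scaleC adjoint_bound)

lemma norm_adjoint_le: "norm (adjoint T f) \<le> K * norm f"
  unfolding adjoint_def
  by (rule norm_CDual_le)
    (simp_all add: map_add map_scaleC cdual_apply_add cdual_apply_scaleC adjoint_bound
      bound_nonneg)

text \<open>The adjoint meets the same hypotheses with the same constant, so that everything above also
  holds for the double adjoint \<open>adjoint (adjoint T)\<close>.\<close>

lemma bounded_complex_linear_adjoint: "bounded_complex_linear (adjoint T) K"
  by unfold_locales
    (auto intro!: cdual_eqI simp: apply_adjoint norm_adjoint_le bound_nonneg)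

interpretation adj: bounded_complex_linear "adjoint T" K
  by (rule bounded_complex_linear_adjoint)

lemma double_adjoint_canonical_embedding: "adjoint (adjoint T) (\<kappa> x) = \<kappa> (T x)"
  by (rule cdual_eqI) (simp add: adj.apply_adjoint apply_adjoint cdual_apply_\<kappa>)

end


section \<open>Homomorphisms and the first Arens product\<close>

locale bounded_algebra_hom = bounded_complex_linear T K +
  dom: banach_algebra_product mlt + cod: banach_algebra_product mlt'
  for T :: "'c::{complex_normed_vector, banach} \<Rightarrow> 'd::{complex_normed_vector, banach}" and K
    and mlt and mlt' +
  assumes map_mult: "T (mlt x y) = mlt' (T x) (T y)"
begin

interpretation adj: bounded_complex_linear "adjoint T" K
  by (rule bounded_complex_linear_adjoint)

text \<open>Multiplicativity of \<open>T\<^sup>*\<^sup>*\<close> is obtained along the three stages that define the Arens product: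
  \<open>T\<^sup>*\<close> intertwines the two module actions, once the acting element of the domain or of its second
  dual is pushed forward by \<open>T\<close> or \<open>T\<^sup>*\<^sup>*\<close>.\<close>

lemma dual_act_adjoint: "dual_act mlt (adjoint T f) x = adjoint T (dual_act mlt' f (T x))"
  by (rule cdual_eqI) (simp add: dom.apply_dual_act cod.apply_dual_act apply_adjoint map_mult)

lemma bidual_act_adjoint:
  "bidual_act mlt n (adjoint T f) = adjoint T (bidual_act mlt' (adjoint (adjoint T) n) f)"
  by (rule cdual_eqI)
    (simp add: dom.apply_bidual_act cod.apply_bidual_act apply_adjoint adj.apply_adjoint
      dual_act_adjoint)

lemma arens_double_adjoint:
  "adjoint (adjoint T) (arens mlt m n)
    = arens mlt' (adjoint (adjoint T) m) (adjoint (adjoint T) n)"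
  by (rule cdual_eqI)
    (simp add: dom.apply_arens cod.apply_arens adj.apply_adjoint bidual_act_adjoint)

end


section \<open>Images of ultra central approximate identities\<close>

lemma net_norm_converges_bounded_image:
  assumes "bounded_complex_linear S K" and "net_norm_converges I le x l"
  shows "net_norm_converges I le (\<lambda>i. S (x i)) (S l)"
  unfolding net_norm_converges_def
proof (intro allI impI)
  interpret bounded_complex_linear S K by fact
  fix \<epsilon> :: real assume "\<epsilon> > 0"
  \<comment> \<open>\<open>K\<close> may be \<open>0\<close>, hence the divisor \<open>K + 1\<close>.\<close>
  then have "\<epsilon> / (K + 1) > 0" using bound_nonneg by simp
  then obtain i\<^sub>0 where i\<^sub>0: "i\<^sub>0 \<in> I" "\<forall>i\<in>I. le i\<^sub>0 i \<longrightarrow> norm (x i - l) < \<epsilon> / (K + 1)"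
    using assms(2) unfolding net_norm_converges_def by blast
  have "norm (S (x i) - S l) < \<epsilon>" if "i \<in> I" "le i\<^sub>0 i" for i
  proof -
    have "norm (S (x i) - S l) \<le> K * norm (x i - l)"
      using norm_map_le[of "x i - l"] by (simp add: map_diff)
    also have "\<dots> \<le> (K + 1) * norm (x i - l)" by (intro mult_right_mono) simp_all
    also have "\<dots> < \<epsilon>" using i\<^sub>0(2) that bound_nonneg by (simp add: field_simps)
    finally show ?thesis .
  qed
  then show "\<exists>i\<^sub>0\<in>I. \<forall>i\<in>I. le i\<^sub>0 i \<longrightarrow> norm (S (x i) - S l) < \<epsilon>" using i\<^sub>0(1) by blast
qed

text \<open>The convergence is known on the range of \<open>T\<close> only. For a range that is merely dense, passing
  to its closure would take a bounded net, and the net may be unbounded; hence \<open>surj T\<close>.\<close>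

lemma (in bounded_algebra_hom) ultra_central_approximate_identity_image:
  assumes "surj T" and "ultra_central_approximate_identity mlt I le e"
  shows "ultra_central_approximate_identity mlt' I le (\<lambda>i. adjoint (adjoint T) (e i))"
  unfolding ultra_central_approximate_identity_def
proof (intro conjI allI ballI)
  interpret adj: bounded_complex_linear "adjoint T" K
    by (rule bounded_complex_linear_adjoint)
  let ?S = "adjoint (adjoint T)"
  note e = assms(2)[unfolded ultra_central_approximate_identity_def]
  show "directed_set I le" using e by blast
  fix d
  obtain x where d: "d = T x" using assms(1) by (meson surjD)
  show "arens mlt' (\<kappa> d) (?S (e i)) = arens mlt' (?S (e i)) (\<kappa> d)" if "i \<in> I" for i
  proof -
    have "arens mlt (\<kappa> x) (e i) = arens mlt (e i) (\<kappa> x)" using e that by blast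
    then have "?S (arens mlt (\<kappa> x) (e i)) = ?S (arens mlt (e i) (\<kappa> x))" by (rule arg_cong)
    then show ?thesis
      by (simp only: d arens_double_adjoint double_adjoint_canonical_embedding)
  qed
  have "net_norm_converges I le (\<lambda>i. ?S (arens mlt (e i) (\<kappa> x))) (?S (\<kappa> x))"
    using e by (intro net_norm_converges_bounded_image[OF adj.bounded_complex_linear_adjoint]) blast
  then show "net_norm_converges I le (\<lambda>i. arens mlt' (?S (e i)) (\<kappa> d)) (\<kappa> d)"
    by (simp only: d arens_double_adjoint double_adjoint_canonical_embedding)
qed


section \<open>The projection of a Lau product\<close>

lemma bounded_algebra_hom_l1_snd:
  fixes \<phi> :: "'b::complex_banach_algebra \<Rightarrow> complex"
  assumes "\<phi> \<in> \<Delta>"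
  shows "bounded_algebra_hom (l1_snd :: ('a::complex_banach_algebra, 'b) l1_prod \<Rightarrow> 'b) 1
    (lau_mult \<phi>) (*)"
proof -
  interpret dom: banach_algebra_product "lau_mult \<phi> :: ('a, 'b) l1_prod \<Rightarrow> _ \<Rightarrow> _"
    by (rule banach_algebra_product_lau_mult) fact
  interpret cod: banach_algebra_product "(*) :: 'b \<Rightarrow> 'b \<Rightarrow> 'b"
    by (rule banach_algebra_product_times)
  show ?thesis by unfold_locales (simp_all add: l1_prod_defs lau_mult_def)
qed

theorem proposition5p6:
  fixes \<phi> :: "'b::complex_banach_algebra \<Rightarrow> complex"
  assumes "\<phi> \<in> \<Delta>"
    and "has_ultra_central_approximate_identity
           (lau_mult \<phi> :: ('a::complex_banach_algebra, 'b) l1_prod \<Rightarrow> _ \<Rightarrow> _)"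
  shows "has_ultra_central_approximate_identity ((*) :: 'b \<Rightarrow> 'b \<Rightarrow> 'b)"
proof -
  interpret bounded_algebra_hom "l1_snd :: ('a, 'b) l1_prod \<Rightarrow> 'b" 1 "lau_mult \<phi>" "(*)"
    by (rule bounded_algebra_hom_l1_snd) fact
  obtain I :: "(('a, 'b) l1_prod set \<times> nat) set" and le e
    where "ultra_central_approximate_identity
      (lau_mult \<phi> :: ('a, 'b) l1_prod \<Rightarrow> _ \<Rightarrow> _) I le e"
    using assms(2) unfolding has_ultra_central_approximate_identity_def by blast
  moreover have "surj (l1_snd :: ('a, 'b) l1_prod \<Rightarrow> 'b)"
    by (rule surjI[where f = "L1 0"]) simp
  ultimately show ?thesis
    \<comment> \<open>The net keeps its index set, whose type is not the one that the definition of the property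
      prescribes for \<open>\<B>\<close>; the introduction rule accepts any index type.\<close>
    by (intro has_ultra_central_approximate_identityI[OF ultra_central_approximate_identity_image])
qed

end
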